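(* Let $V$ be a finite set and let $k$ be a positive integer. Let $\mathcal{F}\subseteq 2^V$ be the complement of a $k$-hierarchical lattice, and let $f:2^V\to\mathbb{Z}$ be a submodular function. Let $X^*\in\mathcal{F}$ be a minimal minimizer of $f$ over $\mathcal{F}$. Then there exist $S,T\subseteq V$ with $S\cap T=\emptyset$ and $\max\{|S|,|T|\}\le k$ such that $X^*$ is the unique minimal minimizer of $f$ over the lattice $[S,T]$.
   Context: A set function $f:2^V\to\mathbb{Z}$ is submodular if $f(X)+f(Y)\ge f(X\cup Y)+f(X\cap Y)$ for all $X,Y\subseteq V$. A family $\mathcal{H}\subseteq 2^V$ is a $k$-hierarchical lattice if there exists a chain of families $\emptyset=\mathcal{H}_0\subseteq\mathcal{H}_1\subseteq\cdots\subseteq\mathcal{H}_k=\mathcal{H}$ (where $\mathcal{H}_0$ is the empty family) such that for all $i=1,\ldots,k$ and all $X,Y\in\mathcal{H}_i\setminus\mathcal{H}_{i-1}$, either both $X\cup Y$ and $X\cap Y$ belong to $\mathcal{H}_i\setminus\mathcal{H}_{i-1}$, or at least one of $X\cup Y$, $X\cap Y$ belongs to $\mathcal{H}_{i-1}$. A family $\mathcal{F}\subseteq 2^V$ is the complement of a $k$-hierarchical lattice if $2^V\setminus\mathcal{F}$ is a $k$-hierarchical lattice. For disjoint $S,T\subseteq V$, $[S,T]:=\{X\subseteq V\mid S\subseteq X\subseteq V\setminus T\}$. A family of sets is called a lattice if it is closed under union and intersection of two members. A minimizer of $f$ over a family $\mathcal{G}\subseteq 2^V$ is a set $X\in\mathcal{G}$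 with $f(X)\le f(Y)$ for all $Y\in\mathcal{G}$; it is a minimal minimizer over $\mathcal{G}$ if no proper subset of it is a minimizer of $f$ over $\mathcal{G}$ (minimality with respect to inclusion). *)

theory Defs
  imports Main
begin

text \<open>
  A set function on the power set of \<open>V\<close> is a total function on \<open>'a set\<close>;
  its values outside \<open>Pow V\<close> are irrelevant.
\<close>

definition submodular_on :: "'a set \<Rightarrow> ('a set \<Rightarrow> int) \<Rightarrow> bool" where
  "submodular_on V f \<longleftrightarrow>
     (\<forall>X Y. X \<subseteq> V \<longrightarrow> Y \<subseteq> V \<longrightarrow> f X + f Y \<ge> f (X \<union> Y) + f (X \<inter> Y))"

definition hierarchical_lattice :: "'a set \<Rightarrow> nat \<Rightarrow> 'a set set \<Rightarrow> bool" where
  "hierarchical_lattice V k H \<longleftrightarrow> H \<subseteq> Pow V \<and>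
     (\<exists>C :: nat \<Rightarrow> 'a set set.
        C 0 = {} \<and> C k = H \<and> (\<forall>i\<in>{1..k}. C (i - 1) \<subseteq> C i) \<and>
        (\<forall>i\<in>{1..k}. \<forall>X \<in> C i - C (i - 1). \<forall>Y \<in> C i - C (i - 1).
           (X \<union> Y \<in> C i - C (i - 1) \<and> X \<inter> Y \<in> C i - C (i - 1)) \<or>
           (X \<union> Y \<in> C (i - 1) \<or> X \<inter> Y \<in> C (i - 1))))"

definition complement_hierarchical_lattice :: "'a set \<Rightarrow> nat \<Rightarrow> 'a set set \<Rightarrow> bool" where
  "complement_hierarchical_lattice V k F \<longleftrightarrow>
     F \<subseteq> Pow V \<and> hierarchical_lattice V k (Pow V - F)"

definition lattice_interval :: "'a set \<Rightarrow> 'a set \<Rightarrow> 'a set \<Rightarrow> 'a set set" where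
  "lattice_interval V S T = {X. S \<subseteq> X \<and> X \<subseteq> V - T}"

definition minimizer_over :: "('a set \<Rightarrow> int) \<Rightarrow> 'a set set \<Rightarrow> 'a set \<Rightarrow> bool" where
  "minimizer_over f G X \<longleftrightarrow> X \<in> G \<and> (\<forall>Y\<in>G. f X \<le> f Y)"

definition minimal_minimizer_over :: "('a set \<Rightarrow> int) \<Rightarrow> 'a set set \<Rightarrow> 'a set \<Rightarrow> bool" where
  "minimal_minimizer_over f G X \<longleftrightarrow>
     minimizer_over f G X \<and> (\<forall>Y. Y \<subset> X \<longrightarrow> \<not> minimizer_over f G Y)"

end

theory Submission
  imports Defs
begin

text \<open>
  The conditions imposed on \<open>S\<close> and \<open>T\<close> separately are purely combinatorial: \<open>S \<subseteq> Xstar\<close> is chosen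
  so that no subset of \<open>Xstar\<close> outside \<open>F\<close> contains \<open>S\<close>, and dually \<open>T\<close> so that no superset of
  \<open>Xstar\<close> outside \<open>F\<close> avoids \<open>T\<close>; one element per level of the hierarchy suffices. For
  \<open>X \<in> [S, T]\<close>, both \<open>X \<inter> Xstar\<close> and \<open>X \<union> Xstar\<close> then lie in \<open>F\<close>, hence have value at least
  \<open>f Xstar\<close>, and a single application of submodularity to \<open>X\<close> and \<open>Xstar\<close> concludes.
\<close>

lemma hierarchical_latticeE:
  assumes "hierarchical_lattice V k H"
  obtains C where "C 0 = {}" "C k = H"
    "\<And>i. i \<in> {1..k} \<Longrightarrow> C (i - 1) \<subseteq> C i"
    "\<And>i A B. i \<in> {1..k} \<Longrightarrow> A \<in> C i - C (i - 1) \<Longrightarrow> B \<in> C i - C (i - 1) \<Longrightarrow>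
      (A \<union> B \<in> C i - C (i - 1) \<and> A \<inter> B \<in> C i - C (i - 1)) \<or>
      (A \<union> B \<in> C (i - 1) \<or> A \<inter> B \<in> C (i - 1))"
  using assms unfolding hierarchical_lattice_def
  by (elim conjE exE) (rule that, assumption, assumption, erule (1) bspec, drule (1) bspec, drule (1) bspec, erule (1) bspec)

text \<open>Induction on the level \<open>i\<close>, starting from the empty set at the empty level
  0. If some members of level \<open>Suc i\<close> still lie between \<open>S\<close> and
  \<open>X\<close>, they have a largest one, and a single further element of \<open>X\<close>
  outside it excludes them all.\<close>

lemma hierarchical_lattice_subset_separator:
  assumes "finite X" and H: "hierarchical_lattice V k H" and "X \<notin> H"
  obtains S where "S \<subseteq> X" "card S \<le> k" "\<And>Z. Z \<in> H \<Longrightarrow> Z \<subseteq> X \<Longrightarrow> \<not> S \<subseteq> Z"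
proof -
  from H obtain C where C0: "C 0 = {}" and Ck: "C k = H"
    and mono: "\<And>i. i \<in> {1..k} \<Longrightarrow> C (i - 1) \<subseteq> C i"
    and layer: "\<And>i A B. i \<in> {1..k} \<Longrightarrow> A \<in> C i - C (i - 1) \<Longrightarrow> B \<in> C i - C (i - 1) \<Longrightarrow>
      (A \<union> B \<in> C i - C (i - 1) \<and> A \<inter> B \<in> C i - C (i - 1)) \<or>
      (A \<union> B \<in> C (i - 1) \<or> A \<inter> B \<in> C (i - 1))"
    by (erule hierarchical_latticeE)
  have sub: "C i \<subseteq> H" if "i \<le> k" for i
    using that
  proof (induction i rule: inc_induct)
    case base
    show ?case using Ck by simp
  next
    case (step n)
    then show ?case using mono[of "Suc n"] by simp
  qed
  have "\<exists>S\<subseteq>X. card S \<le> i \<and> (\<forall>Z\<in>C i. Z \<subseteq> X \<longrightarrow> \<not> S \<subseteq> Z)" if "i \<le> k" for i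
    using that
  proof (induction i)
    case 0
    then show ?case using C0 by auto
  next
    case (Suc i)
    then obtain S where S: "S \<subseteq> X" "card S \<le> i" "\<forall>Z\<in>C i. Z \<subseteq> X \<longrightarrow> \<not> S \<subseteq> Z"
      by auto
    define A where "A = {Z \<in> C (Suc i). S \<subseteq> Z \<and> Z \<subseteq> X}"
    \<comment> \<open>By choice of \<open>S\<close> no union or intersection of members of \<open>A\<close> drops to level \<open>i\<close>.\<close>
    have "finite A"
      unfolding A_def by (rule finite_subset[of _ "Pow X"]) (use \<open>finite X\<close> in auto)
    have un: "Y \<union> Z \<in> A" if "Y \<in> A" "Z \<in> A" for Y Z
    proof -
      have "Y \<union> Z \<notin> C i" "Y \<inter> Z \<notin> C i" "Y \<notin> C i" "Z \<notin> C i"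
        using that S(3) unfolding A_def by auto
      then show ?thesis
        using layer[of "Suc i" Y Z] that Suc.prems by (auto simp: A_def)
    qed
    show ?case
    proof (cases "A = {}")
      case True
      then show ?thesis using S unfolding A_def by (intro exI[of _ S]) auto
    next
      case False
      \<comment> \<open>A finite nonempty family closed under binary union contains its own union.
        So \<open>\<Union>A\<close> is in \<open>H\<close>, whereas \<open>X\<close> is not, which
        leaves room for \<open>s\<close>.\<close>
      have "\<Union>A \<in> A"
        using \<open>finite A\<close> False un by (intro finite_Sup_in) auto
      then have "\<Union>A \<subseteq> X" "\<Union>A \<noteq> X"
        using sub[OF Suc.prems] \<open>X \<notin> H\<close> unfolding A_def by auto
      then obtain s where s: "s \<in> X" "s \<notin> \<Union>A"
        by blast
      have "card (insert s S) \<le> Suc i"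
        using S(1,2) \<open>finite X\<close> by (simp add: card_insert_if finite_subset)
      moreover have "\<not> insert s S \<subseteq> Z" if "Z \<in> C (Suc i)" "Z \<subseteq> X" for Z
        using that s(2) unfolding A_def by blast
      ultimately show ?thesis
        using s(1) S(1) by (intro exI[of _ "insert s S"]) auto
    qed
  qed
  from this[OF order_refl] obtain S where "S \<subseteq> X" "card S \<le> k" "\<forall>Z\<in>H. Z \<subseteq> X \<longrightarrow> \<not> S \<subseteq> Z"
    unfolding Ck by (elim exE conjE)
  then show ?thesis
    by (intro that[of S]) simp_all
qed

text \<open>Complementation in \<open>V\<close> exchanges union and intersection, and the layer
  condition is symmetric in the two. This duality turns separation from subsets into separation from
  supersets.\<close>

lemma hierarchical_lattice_complements:
  assumes "hierarchical_lattice V k H"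
  shows "hierarchical_lattice V k {Z. Z \<subseteq> V \<and> V - Z \<in> H}"
proof -
  from assms obtain C where C0: "C 0 = {}" and Ck: "C k = H"
    and mono: "\<And>i. i \<in> {1..k} \<Longrightarrow> C (i - 1) \<subseteq> C i"
    and layer: "\<And>i A B. i \<in> {1..k} \<Longrightarrow> A \<in> C i - C (i - 1) \<Longrightarrow> B \<in> C i - C (i - 1) \<Longrightarrow>
      (A \<union> B \<in> C i - C (i - 1) \<and> A \<inter> B \<in> C i - C (i - 1)) \<or>
      (A \<union> B \<in> C (i - 1) \<or> A \<inter> B \<in> C (i - 1))"
    by (erule hierarchical_latticeE)
  define D where "D i = {Z. Z \<subseteq> V \<and> V - Z \<in> C i}" for i
  have layerD: "(A \<union> B \<in> D i - D (i - 1) \<and> A \<inter> B \<in> D i - D (i - 1)) \<or>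
      (A \<union> B \<in> D (i - 1) \<or> A \<inter> B \<in> D (i - 1))"
    if "i \<in> {1..k}" "A \<in> D i - D (i - 1)" "B \<in> D i - D (i - 1)" for i A B
  proof -
    have "A \<subseteq> V" "B \<subseteq> V"
      using that by (auto simp: D_def)
    moreover have "V - (A \<union> B) = (V - A) \<inter> (V - B)" "V - (A \<inter> B) = (V - A) \<union> (V - B)"
      by auto
    ultimately show ?thesis
      using layer[of i "V - A" "V - B"] that unfolding D_def by auto
  qed
  have D0: "D 0 = {}" and Dk: "D k = {Z. Z \<subseteq> V \<and> V - Z \<in> H}"
    using C0 Ck by (auto simp: D_def)
  have monoD: "D (i - 1) \<subseteq> D i" if "i \<in> {1..k}" for i
    using mono[OF that] unfolding D_def by blast
  show ?thesis
    unfolding hierarchical_lattice_def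
    by (intro conjI exI[of _ D] ballI D0 Dk monoD layerD) (assumption | blast)+
qed

text \<open>Dual of the subset separator, applied to \<open>V - X\<close> and the family of
  complements: for \<open>Z\<close> in \<open>H\<close>, \<open>T\<close> is contained in
  \<open>V - Z\<close> exactly when \<open>T\<close> and \<open>Z\<close> are disjoint.\<close>

lemma hierarchical_lattice_superset_separator:
  assumes "finite V" and "X \<subseteq> V" and H: "hierarchical_lattice V k H" and "X \<notin> H"
  obtains T where "T \<subseteq> V - X" "card T \<le> k" "\<And>Z. Z \<in> H \<Longrightarrow> X \<subseteq> Z \<Longrightarrow> T \<inter> Z \<noteq> {}"
proof -
  have "V - (V - X) = X"
    using \<open>X \<subseteq> V\<close> by auto
  then have notin: "V - X \<notin> {Z. Z \<subseteq> V \<and> V - Z \<in> H}"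
    using \<open>X \<notin> H\<close> by auto
  obtain T where T: "T \<subseteq> V - X" "card T \<le> k"
    and sep: "\<And>Z. Z \<in> {Z. Z \<subseteq> V \<and> V - Z \<in> H} \<Longrightarrow> Z \<subseteq> V - X \<Longrightarrow> \<not> T \<subseteq> Z"
    by (rule hierarchical_lattice_subset_separator[OF finite_Diff[OF \<open>finite V\<close>]
        hierarchical_lattice_complements[OF H] notin]) (rule that)
  have "T \<inter> Z \<noteq> {}" if "Z \<in> H" "X \<subseteq> Z" for Z
  proof -
    have "Z \<subseteq> V"
      using H \<open>Z \<in> H\<close> unfolding hierarchical_lattice_def by auto
    then have "V - (V - Z) = Z"
      by auto
    then have "\<not> T \<subseteq> V - Z"
      using sep[of "V - Z"] that by auto
    then show ?thesis
      using T(1) by auto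
  qed
  with T that show ?thesis by blast
qed

theorem theorem2p2:
  fixes V :: "'a set" and k :: nat and F :: "'a set set"
    and f :: "'a set \<Rightarrow> int" and Xstar :: "'a set"
  assumes "finite V"
    and "k \<ge> 1"
    and "complement_hierarchical_lattice V k F"
    and "submodular_on V f"
    and "minimal_minimizer_over f F Xstar"
  shows "\<exists>S T. S \<subseteq> V \<and> T \<subseteq> V \<and> S \<inter> T = {} \<and> max (card S) (card T) \<le> k \<and>
           minimal_minimizer_over f (lattice_interval V S T) Xstar \<and>
           (\<forall>X. minimal_minimizer_over f (lattice_interval V S T) X \<longrightarrow> X = Xstar)"
proof -
  have F: "F \<subseteq> Pow V" and H: "hierarchical_lattice V k (Pow V - F)"
    using assms(3) by (auto simp: complement_hierarchical_lattice_def)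
  have XF: "Xstar \<in> F" and min: "\<And>Y. Y \<in> F \<Longrightarrow> f Xstar \<le> f Y"
    using assms(5) unfolding minimal_minimizer_over_def minimizer_over_def by auto
  \<comment> \<open>The minimality of \<open>Xstar\<close> among minimizers enters only here: a
    proper subset in \<open>F\<close> of no larger value would be a minimizer too.\<close>
  have strict: "f Xstar < f Y" if "Y \<in> F" "Y \<subset> Xstar" for Y
  proof (rule ccontr)
    assume "\<not> f Xstar < f Y"
    then have "minimizer_over f F Y"
      using that(1) min unfolding minimizer_over_def by (meson not_less order_trans)
    then show False
      using assms(5) that(2) unfolding minimal_minimizer_over_def by blast
  qed
  have XV: "Xstar \<subseteq> V" and XH: "Xstar \<notin> Pow V - F"
    using F XF by auto
  obtain S where S: "S \<subseteq> Xstar" "card S \<le> k"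
    and sepS: "\<And>Z. Z \<in> Pow V - F \<Longrightarrow> Z \<subseteq> Xstar \<Longrightarrow> \<not> S \<subseteq> Z"
    using hierarchical_lattice_subset_separator[OF finite_subset[OF XV assms(1)] H XH] by blast
  obtain T where T: "T \<subseteq> V - Xstar" "card T \<le> k"
    and sepT: "\<And>Z. Z \<in> Pow V - F \<Longrightarrow> Xstar \<subseteq> Z \<Longrightarrow> T \<inter> Z \<noteq> {}"
    using hierarchical_lattice_superset_separator[OF assms(1) XV H XH] by blast
  let ?L = "lattice_interval V S T"
  have XL: "Xstar \<in> ?L"
    using S T XV by (auto simp: lattice_interval_def)
  \<comment> \<open>The intersection contains \<open>S\<close> inside \<open>Xstar\<close>, and the
    union avoids \<open>T\<close> above \<open>Xstar\<close>, so the separators keep both out of the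
    complement of \<open>F\<close>.\<close>
  have inter: "Z \<inter> Xstar \<in> F" and union: "Z \<union> Xstar \<in> F" if "Z \<in> ?L" for Z
  proof -
    show "Z \<inter> Xstar \<in> F"
      using sepS[of "Z \<inter> Xstar"] that S XV by (auto simp: lattice_interval_def)
    show "Z \<union> Xstar \<in> F"
      using sepT[of "Z \<union> Xstar"] that T XV by (auto simp: lattice_interval_def)
  qed
  have sm: "f (Z \<union> Xstar) + f (Z \<inter> Xstar) \<le> f Z + f Xstar" if "Z \<in> ?L" for Z
  proof -
    have "Z \<subseteq> V"
      using that by (auto simp: lattice_interval_def)
    then show ?thesis
      using assms(4) XV unfolding submodular_on_def by blast
  qed
  have le: "f Xstar \<le> f Z" if "Z \<in> ?L" for Z
    using sm[OF that] min[OF inter[OF that]] min[OF union[OF that]] by linarith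
  \<comment> \<open>Otherwise \<open>Z \<inter> Xstar\<close> is a proper subset of
    \<open>Xstar\<close> in \<open>F\<close>, and its strictly larger value contradicts
    \<open>sm\<close>. Being contained in every minimizer over \<open>?L\<close> gives both
    minimality and uniqueness.\<close>
  have least: "Xstar \<subseteq> Z" if "Z \<in> ?L" "f Z \<le> f Xstar" for Z
  proof (rule ccontr)
    assume "\<not> Xstar \<subseteq> Z"
    then have "f Xstar < f (Z \<inter> Xstar)"
      by (intro strict inter that) auto
    then show False
      using sm[OF that(1)] min[OF union[OF that(1)]] that(2) by linarith
  qed
  have mm: "minimizer_over f ?L Z \<longleftrightarrow> Z \<in> ?L \<and> f Z \<le> f Xstar" for Z
    using XL le unfolding minimizer_over_def by (meson order_trans)
  have "minimal_minimizer_over f ?L Xstar"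
    using XL least unfolding minimal_minimizer_over_def mm by auto
  moreover have "X = Xstar" if "minimal_minimizer_over f ?L X" for X
    using that XL least[of X] unfolding minimal_minimizer_over_def mm by blast
  moreover have "S \<subseteq> V" "T \<subseteq> V" "S \<inter> T = {}"
    using S T XV by auto
  ultimately show ?thesis
    using S(2) T(2) by (metis max.bounded_iff)
qed

end
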